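(* Let $\mathcal{C}\subseteq\mathbb{R}^n$ be a full-dimensional pointed polyhedral cone with extreme rays $R_1,\dots,R_p$, and let $v=\{v_1,\dots,v_p\}$ be generators with $R_i=\mathbb{R}_{\geq 0}v_i$. Let $\mathcal{B}=\{B_1,\dots,B_r\}$ be a set of real $n\times n$ matrices with $B_1=I_n$. Put $Q=\sum_{i=1}^p v_i v_i^T$ and, for $1\le i,j\le p$, $$w_{ij}=\left(v_i^TQ^{-1}B_1v_j,\ \dots,\ v_i^TQ^{-1}B_rv_j\right).$$ Then $\mathrm{Lin}_v(\mathcal{C},\mathcal{B})$ is exactly the group of permutations $\sigma\in\mathrm{Sym}(p)$ preserving the directed colored graph on vertex set $\{1,\dots,p\}$ in which the (directed) edge $(i,j)$, $i\neq j$, has color $w_{ij}$ and the vertex $i$ has color $w_{ii}$; i.e. the group of all $\sigma\in\mathrm{Sym}(p)$ with $w_{\sigma(i)\sigma(j)}=w_{ij}$ for all $1\le i,j\le p$.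
   Context: A polyhedral cone in $\mathbb{R}^n$ is the set of vectors satisfying finitely many homogeneous linear inequalities; it is assumed full-dimensional and containing no nontrivial linear subspace, so it is generated by its finitely many extreme rays. ($Q$ is then positive definite, hence invertible.) $\mathrm{GL}_v(\mathcal{C})$ denotes the group of matrices $A\in\mathrm{GL}_n(\mathbb{R})$ for which there is $\sigma\in\mathrm{Sym}(p)$ with $Av_i=v_{\sigma(i)}$ for all $i$. $\mathrm{GL}_v(\mathcal{C},\mathcal{B})=\{A\in\mathrm{GL}_v(\mathcal{C}) : AB=BA \text{ for all } B\in\mathcal{B}\}$, and $\mathrm{Lin}_v(\mathcal{C},\mathcal{B})$ is the group of permutations $\sigma\in\mathrm{Sym}(p)$ for which there exists $A\in\mathrm{GL}_v(\mathcal{C},\mathcal{B})$ with $Av_i=v_{\sigma(i)}$ for $1\le i\le p$. *)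

theory Defs
  imports "HOL-Analysis.Analysis" "HOL-Algebra.Sym_Groups"
begin

definition polyhedral_cone :: "'a::euclidean_space set \<Rightarrow> bool" where
  "polyhedral_cone C \<longleftrightarrow> (\<exists>H. finite H \<and> C = {x. \<forall>a\<in>H. a \<bullet> x \<ge> 0})"

definition full_dimensional :: "'a::euclidean_space set \<Rightarrow> bool" where
  "full_dimensional C \<longleftrightarrow> aff_dim C = int DIM('a)"

definition pointed :: "'a::real_vector set \<Rightarrow> bool" where
  "pointed C \<longleftrightarrow> (\<forall>S. subspace S \<and> S \<subseteq> C \<longrightarrow> S = {0})"

text \<open>Extreme rays are the one-dimensional faces; \<open>face_of\<close> admits the improper face \<open>C\<close>,
  so a cone that is itself a ray has one extreme ray.\<close>

definition extreme_rays :: "'a::euclidean_space set \<Rightarrow> 'a set set" where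
  "extreme_rays C = {R. R face_of C \<and> aff_dim R = 1}"

definition ray_of :: "'a::real_vector \<Rightarrow> 'a set" where
  "ray_of x = {c *\<^sub>R x |c. c \<ge> 0}"

text \<open>The matrix groups depend on the cone only through the generators
  \<open>v 1, \<dots>, v p\<close> of its extreme rays.\<close>

definition GL_gens :: "nat \<Rightarrow> (nat \<Rightarrow> real^'n) \<Rightarrow> (real^'n^'n) set" where
  "GL_gens p v = {A. invertible A \<and>
     (\<exists>\<sigma>. \<sigma> permutes {1..p} \<and> (\<forall>i\<in>{1..p}. A *v v i = v (\<sigma> i)))}"

definition GL_gens_comm ::
  "nat \<Rightarrow> (nat \<Rightarrow> real^'n) \<Rightarrow> (real^'n^'n) set \<Rightarrow> (real^'n^'n) set" where
  "GL_gens_comm p v \<B> = {A \<in> GL_gens p v. \<forall>B\<in>\<B>. A ** B = B ** A}"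

definition Lin_gens ::
  "nat \<Rightarrow> (nat \<Rightarrow> real^'n) \<Rightarrow> (real^'n^'n) set \<Rightarrow> (nat \<Rightarrow> nat) set" where
  "Lin_gens p v \<B> = {\<sigma>. \<sigma> permutes {1..p} \<and>
     (\<exists>A \<in> GL_gens_comm p v \<B>. \<forall>i\<in>{1..p}. A *v v i = v (\<sigma> i))}"

definition Q_matrix :: "nat \<Rightarrow> (nat \<Rightarrow> real^'n) \<Rightarrow> real^'n^'n" where
  "Q_matrix p v =
     (\<Sum>i=1..p. (columnvector (v i) :: real^1^'n) ** (rowvector (v i) :: real^'n^1))"

definition edge_weight ::
  "nat \<Rightarrow> (nat \<Rightarrow> real^'n) \<Rightarrow> nat \<Rightarrow> (nat \<Rightarrow> real^'n^'n) \<Rightarrow> nat \<Rightarrow> nat \<Rightarrow> real list" where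
  "edge_weight p v r B i j =
     map (\<lambda>k. v i \<bullet> ((matrix_inv (Q_matrix p v) ** B k) *v v j)) [1..<Suc r]"

text \<open>Automorphisms of the complete directed graph on \<open>V\<close> (without loops) with vertex
  colors \<open>vcol\<close> and edge colors \<open>ecol\<close>.\<close>

definition colored_digraph_auts ::
  "'v set \<Rightarrow> ('v \<Rightarrow> 'c) \<Rightarrow> ('v \<Rightarrow> 'v \<Rightarrow> 'd) \<Rightarrow> ('v \<Rightarrow> 'v) set" where
  "colored_digraph_auts V vcol ecol = {\<sigma>. \<sigma> permutes V \<and>
     (\<forall>i\<in>V. vcol (\<sigma> i) = vcol i) \<and>
     (\<forall>i\<in>V. \<forall>j\<in>V. i \<noteq> j \<longrightarrow> ecol (\<sigma> i) (\<sigma> j) = ecol i j)}"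

end

theory Submission
  imports Defs
begin

text \<open>
  A slice of the cone by a hyperplane transverse to it is compact, and by Krein--Milman it is the
  convex hull of its extreme points, which lie on the extreme rays; hence the generators
  \<open>v i\<close> span the space and \<open>Q\<close> is invertible. If \<open>A\<close> permutes the generators, then
  \<open>A Q A\<^sup>T = Q\<close>, so \<open>A\<close> preserves the form \<open>x\<^sup>T Q\<^sup>-\<^sup>1 y\<close>, and all weights if it commutes with the
  \<open>B k\<close>. Conversely, a weight-preserving \<open>\<sigma>\<close> is realised by
  \<open>A = (\<Sum>i. v (\<sigma> i) (v i)\<^sup>T) Q\<^sup>-\<^sup>1\<close>: the identities \<open>A v j = v (\<sigma> j)\<close> and \<open>A B k = B k A\<close> can be
  tested against the spanning vectors \<open>v (\<sigma> i)\<close> in the form \<open>x\<^sup>T Q\<^sup>-\<^sup>1 y\<close>.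
\<close>

section \<open>Extreme rays span a pointed full-dimensional cone\<close>

text \<open>Suppose a point of the ray lies inside a segment of \<open>C\<close> with nonzero
  endpoints. Rescaling both endpoints to height \<open>h = 1\<close> writes \<open>e\<close> as a
  proper convex combination of two points of the slice, so extremality makes both of them equal to
  \<open>e\<close>.\<close>

lemma face_of_ray_of_extreme_point_slice:
  fixes C :: "'a::euclidean_space set"
  assumes cone: "\<And>x c. x \<in> C \<Longrightarrow> 0 \<le> c \<Longrightarrow> c *\<^sub>R x \<in> C"
    and pos: "\<And>x. x \<in> C \<Longrightarrow> x \<noteq> 0 \<Longrightarrow> h \<bullet> x > 0"
    and e: "e extreme_point_of (C \<inter> {x. h \<bullet> x = 1})"
  shows "ray_of e face_of C"
proof -
  have eC: "e \<in> C" and he: "h \<bullet> e = 1"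
    using e by (auto simp: extreme_point_of_def)
  have in_ray: "a \<in> ray_of e"
    if a: "a \<in> C" and b: "b \<in> C" and c: "0 \<le> c" and u: "0 < u" "u < 1"
      and eq: "c *\<^sub>R e = (1 - u) *\<^sub>R a + u *\<^sub>R b" for a b c u
  \<comment> \<open>A zero endpoint has height 0 and cannot be rescaled into the slice; if
    \<open>b = 0\<close>, the equation itself exhibits \<open>a\<close> as a multiple of
    \<open>e\<close>.\<close>
  proof (cases "a = 0 \<or> b = 0")
    case True
    then consider "a = 0" | "b = 0" by blast
    then show ?thesis
    proof cases
      case 1
      then show ?thesis unfolding ray_of_def by (auto intro!: exI[of _ 0])
    next
      case 2
      have "a = (c / (1 - u)) *\<^sub>R e"
        using arg_cong[OF eq, of "\<lambda>x. (1 / (1 - u)) *\<^sub>R x"] u 2 by simp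
      then show ?thesis unfolding ray_of_def using c u by (auto intro!: exI[of _ "c / (1 - u)"])
    qed
  next
    case False
    define \<alpha> \<beta> where "\<alpha> = h \<bullet> a" and "\<beta> = h \<bullet> b"
    have ab: "\<alpha> > 0" "\<beta> > 0" using pos a b False by (auto simp: \<alpha>_def \<beta>_def)
    have c_eq: "c = (1 - u) * \<alpha> + u * \<beta>"
      using arg_cong[OF eq, of "\<lambda>x. h \<bullet> x"] he by (simp add: inner_add_right \<alpha>_def \<beta>_def)
    have cpos: "c > 0" using c_eq ab u by (simp add: add_pos_pos)
    define a' b' where "a' = (1 / \<alpha>) *\<^sub>R a" and "b' = (1 / \<beta>) *\<^sub>R b"
    \<comment> \<open>The point \<open>c *\<^sub>R e\<close> has height \<open>c\<close>, and
      \<open>t\<close> is the fraction of this height contributed by \<open>b\<close>; these are the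
      weights after rescaling.\<close>
    define t where "t = u * \<beta> / c"
    have S: "a' \<in> C \<inter> {x. h \<bullet> x = 1}" "b' \<in> C \<inter> {x. h \<bullet> x = 1}"
      using cone[OF a, of "1 / \<alpha>"] cone[OF b, of "1 / \<beta>"] ab
      by (auto simp: a'_def b'_def \<alpha>_def \<beta>_def)
    have t: "0 < t" "t < 1" using u ab cpos c_eq by (auto simp: t_def)
    have "1 - t = (1 - u) * \<alpha> / c" using cpos c_eq by (simp add: t_def field_simps)
    then have "(1 - t) *\<^sub>R a' + t *\<^sub>R b' = (1 / c) *\<^sub>R ((1 - u) *\<^sub>R a + u *\<^sub>R b)"
      using ab by (simp add: a'_def b'_def t_def scaleR_add_right)
    also have "\<dots> = e" using cpos by (simp flip: eq)
    finally have e_eq: "e = (1 - t) *\<^sub>R a' + t *\<^sub>R b'" by simp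
    have "a' = b'"
    proof (rule ccontr)
      assume "a' \<noteq> b'"
      then have "e \<in> open_segment a' b'" using e_eq t by (auto simp: in_segment)
      then show False using e S by (auto simp: extreme_point_of_def)
    qed
    then have "e = a'" using e_eq by (simp flip: scaleR_add_left)
    then have "a = \<alpha> *\<^sub>R e" using ab by (simp add: a'_def)
    then show ?thesis using ab by (auto simp: ray_of_def intro!: exI[of _ \<alpha>])
  qed
  show ?thesis
    unfolding face_of_def
  proof (intro conjI ballI impI)
    show "ray_of e \<subseteq> C" using cone[OF eC] by (auto simp: ray_of_def)
    show "convex (ray_of e)"
      unfolding convex_def
    proof (intro ballI allI impI)
      fix x y and s t :: real
      assume "x \<in> ray_of e" "y \<in> ray_of e" and st: "0 \<le> s" "0 \<le> t"
      then obtain c d where cd: "x = c *\<^sub>R e" "y = d *\<^sub>R e" "c \<ge> 0" "d \<ge> 0"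
        by (auto simp: ray_of_def)
      have "s *\<^sub>R x + t *\<^sub>R y = (s * c + t * d) *\<^sub>R e"
        using cd by (simp add: scaleR_add_left)
      moreover have "s * c + t * d \<ge> 0" using cd st by simp
      ultimately show "s *\<^sub>R x + t *\<^sub>R y \<in> ray_of e" unfolding ray_of_def by blast
    qed
  next
    fix a b x assume H: "a \<in> C" "b \<in> C" "x \<in> ray_of e" "x \<in> open_segment a b"
    obtain c where c: "x = c *\<^sub>R e" "c \<ge> 0" using H by (auto simp: ray_of_def)
    obtain u where u: "0 < u" "u < 1" "x = (1 - u) *\<^sub>R a + u *\<^sub>R b"
      using H by (auto simp: in_segment)
    show "a \<in> ray_of e" using in_ray[of a b c u] H c u by simp
    \<comment> \<open>The segment is read backwards, so \<open>u\<close> becomes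
      \<open>1 - u\<close>.\<close>
    show "b \<in> ray_of e" using in_ray[of b a c "1 - u"] H c u by (simp add: add.commute)
  qed
qed

lemma aff_dim_ray_of:
  fixes e :: "'a::euclidean_space"
  assumes "e \<noteq> 0"
  shows "aff_dim (ray_of e) = 1"
proof -
  have 0: "0 \<in> ray_of e" and e: "e \<in> ray_of e"
    unfolding ray_of_def by (auto intro: exI[of _ 0] exI[of _ 1])
  have "span (ray_of e) = span {e}"
  proof (rule span_eq[THEN iffD2], intro conjI subsetI)
    fix x assume "x \<in> ray_of e"
    then show "x \<in> span {e}" by (auto simp: ray_of_def span_singleton)
  next
    fix x assume "x \<in> {e}"
    then show "x \<in> span (ray_of e)" using e by (simp add: span_base)
  qed
  then have "dim (ray_of e) = dim {e}" by (metis dim_span)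
  then show ?thesis
    using assms aff_dim_zero[of "ray_of e"] 0 by (simp add: hull_inc)
qed

text \<open>Every nonzero point of the cone is a positive multiple of a point of the compact slice
  \<open>S\<close>, and each extreme point of \<open>S\<close> generates an extreme ray.\<close>

lemma polyhedral_cone_subset_span_extreme_rays:
  fixes C :: "'a::euclidean_space set"
  assumes "polyhedral_cone C" "pointed C"
  shows "C \<subseteq> span (\<Union> (extreme_rays C))"
proof -
  obtain H where H: "finite H" and C: "C = {x. \<forall>a\<in>H. a \<bullet> x \<ge> 0}"
    using assms by (auto simp: polyhedral_cone_def)
  have cone: "c *\<^sub>R x \<in> C" if "x \<in> C" "0 \<le> c" for x c
    using that by (simp add: C)
  have "C = (\<Inter>a\<in>H. {x. a \<bullet> x \<ge> 0})" by (auto simp: C)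
  then have clC: "closed C" and convC: "convex C"
    by (auto intro!: closed_INT closed_halfspace_ge convex_INT convex_halfspace_ge)
  \<comment> \<open>The sum of the defining normals is nonnegative on \<open>C\<close>. If it
    vanishes at a point \<open>x\<close> of \<open>C\<close>, every normal does, so the whole line
    through \<open>x\<close> lies in \<open>C\<close>, and pointedness gives
    \<open>x = 0\<close>.\<close>
  define h where "h = \<Sum> H"
  have pos: "h \<bullet> x > 0" if x: "x \<in> C" and nz: "x \<noteq> 0" for x
  proof (rule ccontr)
    assume "\<not> h \<bullet> x > 0"
    moreover have hx: "h \<bullet> x = (\<Sum>a\<in>H. a \<bullet> x)" by (simp add: h_def inner_sum_left)
    moreover have ge: "a \<bullet> x \<ge> 0" if "a \<in> H" for a using x that by (simp add: C)
    ultimately have "(\<Sum>a\<in>H. a \<bullet> x) = 0" by (simp add: sum_nonneg antisym)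
    then have "\<forall>a\<in>H. a \<bullet> x = 0" using ge H
      by (subst (asm) sum_nonneg_eq_0_iff) auto
    then have "span {x} \<subseteq> C" by (auto simp: C span_singleton)
    then have "span {x} = {0}" using assms(2) by (auto simp: pointed_def)
    then show False using nz span_base[of x "{x}"] by auto
  qed
  define S where "S = C \<inter> {x. h \<bullet> x = 1}"
  \<comment> \<open>By homogeneity \<open>h \<bullet> x\<close> is at least \<open>norm x\<close>
    times the minimum of \<open>h\<close> over the unit vectors of \<open>C\<close>, and this
    minimum is positive. The minimum exists only if \<open>C\<close> has unit vectors; otherwise
    \<open>S\<close> is empty.\<close>
  have "bounded S"
  proof (cases "C \<inter> sphere 0 1 = {}")
    case True
    have "S = {}"
    proof (rule ccontr)
      assume "S \<noteq> {}"
      then obtain x where "x \<in> C" "h \<bullet> x = 1" by (auto simp: S_def)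
      then have x: "x \<in> C" "x \<noteq> 0" by auto
      then have "(1 / norm x) *\<^sub>R x \<in> C \<inter> sphere 0 1" using cone by auto
      then show False using True by blast
    qed
    then show ?thesis by simp
  next
    case False
    have "compact (C \<inter> sphere 0 1)" using clC by (simp add: closed_Int_compact)
    moreover have "continuous_on (C \<inter> sphere 0 1) (\<lambda>x. h \<bullet> x)" by (intro continuous_intros)
    ultimately obtain m where m: "m \<in> C \<inter> sphere 0 1" and
      min: "\<And>y. y \<in> C \<inter> sphere 0 1 \<Longrightarrow> h \<bullet> m \<le> h \<bullet> y"
      using continuous_attains_inf[OF _ False] by blast
    have hm: "h \<bullet> m > 0" using m by (intro pos) auto
    have "norm x \<le> 1 / (h \<bullet> m)" if x: "x \<in> S" for x
    proof -
      have nz: "x \<noteq> 0" and "x \<in> C" and hx: "h \<bullet> x = 1" using x by (auto simp: S_def)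
      then have "(1 / norm x) *\<^sub>R x \<in> C \<inter> sphere 0 1" using cone by auto
      from min[OF this] show ?thesis using hx nz hm by (simp add: field_simps)
    qed
    then show ?thesis by (auto simp: bounded_iff)
  qed
  moreover have "closed S" unfolding S_def by (intro closed_Int clC closed_hyperplane)
  ultimately have "compact S" by (simp add: compact_eq_bounded_closed)
  moreover have "convex S" unfolding S_def by (intro convex_Int convC convex_hyperplane)
  ultimately have KM: "S = convex hull {x. x extreme_point_of S}"
    by (rule Krein_Milman_Minkowski)
  have "{x. x extreme_point_of S} \<subseteq> \<Union> (extreme_rays C)"
  proof
    fix e assume "e \<in> {x. x extreme_point_of S}"
    then have e: "e extreme_point_of (C \<inter> {x. h \<bullet> x = 1})" by (simp add: S_def)
    then have "e \<noteq> 0" by (auto simp: extreme_point_of_def)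
    then have "ray_of e \<in> extreme_rays C"
      using face_of_ray_of_extreme_point_slice[OF cone pos e] aff_dim_ray_of
      by (simp add: extreme_rays_def)
    moreover have "e \<in> ray_of e" by (auto simp: ray_of_def intro: exI[of _ 1])
    ultimately show "e \<in> \<Union> (extreme_rays C)" by blast
  qed
  then have S_span: "S \<subseteq> span (\<Union> (extreme_rays C))"
    using KM convex_hull_subset_span hull_mono by (metis dual_order.trans)
  show ?thesis
  proof
    fix x assume x: "x \<in> C"
    show "x \<in> span (\<Union> (extreme_rays C))"
    proof (cases "x = 0")
      case False
      then have hx: "h \<bullet> x > 0" using pos x by simp
      then have "(1 / (h \<bullet> x)) *\<^sub>R x \<in> S" using cone x by (simp add: S_def)
      then have "(h \<bullet> x) *\<^sub>R ((1 / (h \<bullet> x)) *\<^sub>R x) \<in> span (\<Union> (extreme_rays C))"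
        using S_span by (blast intro: span_scale)
      then show ?thesis using hx by simp
    qed (simp add: span_zero)
  qed
qed

text \<open>The span of the generators contains all extreme rays, hence the cone; a subspace
  containing a full-dimensional set is the whole space.\<close>

lemma span_ray_generators:
  fixes C :: "'a::euclidean_space set"
  assumes "polyhedral_cone C" "full_dimensional C" "pointed C"
    and gens: "extreme_rays C = (\<lambda>i. ray_of (v i)) ` I"
  shows "span (v ` I) = UNIV"
proof -
  have "\<Union> (extreme_rays C) \<subseteq> span (v ` I)"
    unfolding gens by (auto simp: ray_of_def intro: span_scale span_base)
  then have "span (\<Union> (extreme_rays C)) \<subseteq> span (v ` I)"
    by (simp add: span_minimal)
  then have "C \<subseteq> span (v ` I)"
    using polyhedral_cone_subset_span_extreme_rays[OF assms(1,3)] by blast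
  then have "aff_dim C \<le> aff_dim (span (v ` I))" by (rule aff_dim_subset)
  then have "dim (span (v ` I)) \<ge> DIM('a)"
    using assms(2) by (simp add: full_dimensional_def aff_dim_subspace)
  then show ?thesis by (metis dim_eq_full dim_span dim_subset_UNIV le_antisym)
qed

section \<open>The form defined by the inverse of \<open>Q\<close>\<close>

text \<open>Presents \<open>Q_matrix\<close> as a sum of rank-one operators, so that later arguments
  avoid matrix entries.\<close>

lemma Q_matrix_mult_vec: "Q_matrix p v *v x = (\<Sum>i=1..p. (v i \<bullet> x) *\<^sub>R v i)"
  unfolding Q_matrix_def
  by (simp add: vec_eq_iff matrix_vector_mult_def matrix_matrix_mult_def columnvector_def
      rowvector_def inner_vec_def sum_distrib_left sum_distrib_right mult_ac)
     (intro allI sum.swap)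

text \<open>The difference \<open>x - y\<close> is orthogonal to a spanning set, hence to
  itself.\<close>

lemma eq_if_inner_spanning_eq:
  fixes x y :: "'a::real_inner"
  assumes "span (v ` I) = UNIV" and "\<And>i. i \<in> I \<Longrightarrow> v i \<bullet> x = v i \<bullet> y"
  shows "x = y"
proof -
  have "orthogonal (x - y) (x - y)"
  proof (rule orthogonal_to_span)
    show "x - y \<in> span (v ` I)" using assms by simp
  next
    fix z assume "z \<in> v ` I"
    then show "orthogonal (x - y) z"
      using assms(2) by (auto simp: orthogonal_def inner_diff_right inner_commute[of "x - y"])
  qed
  then show ?thesis by (simp add: orthogonal_def)
qed

text \<open>The quadratic form of \<open>Q_matrix p v\<close> at \<open>x\<close> is the sum of the
  squares of \<open>v i \<bullet> x\<close>, so a kernel vector is orthogonal to all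
  generators.\<close>

lemma invertible_Q_matrix:
  assumes span: "span (v ` {1..p}) = UNIV"
  shows "invertible (Q_matrix p v)"
proof -
  have "x = 0" if "Q_matrix p v *v x = 0" for x
  proof (rule eq_if_inner_spanning_eq[OF span])
    have "x \<bullet> (Q_matrix p v *v x) = (\<Sum>i=1..p. (v i \<bullet> x)\<^sup>2)"
      by (simp add: Q_matrix_mult_vec inner_sum_right inner_commute power2_eq_square)
    then have "(\<Sum>i=1..p. (v i \<bullet> x)\<^sup>2) = 0" using that by simp
    then have "\<forall>i\<in>{1..p}. (v i \<bullet> x)\<^sup>2 = 0" by (subst (asm) sum_nonneg_eq_0_iff) auto
    then show "v i \<bullet> x = v i \<bullet> 0" if "i \<in> {1..p}" for i using that by simp
  qed
  then show ?thesis
    by (simp add: invertible_left_inverse matrix_left_invertible_ker)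
qed

lemma matrix_inv_Q_matrix:
  assumes "span (v ` {1..p}) = UNIV"
  shows "Q_matrix p v ** matrix_inv (Q_matrix p v) = mat 1 \<and>
         matrix_inv (Q_matrix p v) ** Q_matrix p v = mat 1"
  using invertible_Q_matrix[OF assms] unfolding invertible_def matrix_inv_def by (rule someI_ex)

text \<open>Conjugation replaces each \<open>v i\<close> in the rank-one sum by
  \<open>A *v v i\<close>, that is, by \<open>v (\<sigma> i)\<close>; this only reorders the
  sum.\<close>

lemma Q_matrix_conjugate_perm:
  assumes \<sigma>: "\<sigma> permutes {1..p}" and A: "\<And>i. i \<in> {1..p} \<Longrightarrow> A *v v i = v (\<sigma> i)"
  shows "A ** Q_matrix p v ** transpose A = Q_matrix p v"
proof (rule matrix_eq[THEN iffD2], rule allI)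
  fix x
  have "(A ** Q_matrix p v ** transpose A) *v x = A *v (Q_matrix p v *v (transpose A *v x))"
    by (simp only: matrix_vector_mul_assoc matrix_mul_assoc)
  also have "\<dots> = (\<Sum>i=1..p. (v i \<bullet> (transpose A *v x)) *\<^sub>R (A *v v i))"
    by (simp add: Q_matrix_mult_vec linear_sum[OF matrix_vector_mul_linear] matrix_vector_mult_scaleR)
  also have "\<dots> = (\<Sum>i=1..p. (v (\<sigma> i) \<bullet> x) *\<^sub>R v (\<sigma> i))"
    by (intro sum.cong refl) (metis A dot_lmul_matrix inner_commute transpose_matrix_vector)
  also have "\<dots> = Q_matrix p v *v x"
    unfolding Q_matrix_mult_vec using sum.permute[OF \<sigma>, of "\<lambda>i. (v i \<bullet> x) *\<^sub>R v i"]
    by (simp add: o_def)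
  finally show "(A ** Q_matrix p v ** transpose A) *v x = Q_matrix p v *v x" .
qed

text \<open>With \<open>P\<close> the inverse of \<open>Q\<close>, the identity
  \<open>A Q A^T = Q\<close> says that \<open>Q A^T P\<close> is a right inverse of
  \<open>A\<close>. For square matrices it is also a left inverse, and multiplying by
  \<open>P\<close> gives \<open>A^T P A = P\<close>.\<close>

lemma inner_inverse_Q_matrix_invariant:
  assumes span: "span (v ` {1..p}) = UNIV"
    and \<sigma>: "\<sigma> permutes {1..p}" and A: "\<And>i. i \<in> {1..p} \<Longrightarrow> A *v v i = v (\<sigma> i)"
  shows "(A *v x) \<bullet> (matrix_inv (Q_matrix p v) *v (A *v y)) = x \<bullet> (matrix_inv (Q_matrix p v) *v y)"
proof -
  let ?Q = "Q_matrix p v" and ?P = "matrix_inv (Q_matrix p v)"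
  have P: "?Q ** ?P = mat 1" "?P ** ?Q = mat 1"
    using matrix_inv_Q_matrix[OF span] by simp_all
  have "A ** (?Q ** transpose A ** ?P) = mat 1"
    using Q_matrix_conjugate_perm[where v = v, OF \<sigma> A] P by (simp add: matrix_mul_assoc)
  then have "?Q ** transpose A ** ?P ** A = mat 1" by (simp add: matrix_left_right_inverse)
  then have "?P ** (?Q ** transpose A ** ?P ** A) = ?P" by simp
  then have *: "transpose A ** ?P ** A = ?P" using P by (simp add: matrix_mul_assoc)
  have "(A *v x) \<bullet> (?P *v (A *v y)) = x \<bullet> (transpose A *v (?P *v (A *v y)))"
    by (metis dot_lmul_matrix inner_commute transpose_matrix_vector)
  also have "\<dots> = x \<bullet> ((transpose A ** ?P ** A) *v y)" by (simp only: matrix_vector_mul_assoc matrix_mul_assoc)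
  finally show ?thesis by (simp only: *)
qed

section \<open>Linear symmetries and weight-preserving permutations\<close>

lemma edge_weight_eq_iff:
  "edge_weight p v r B i j = edge_weight p v r B i' j' \<longleftrightarrow>
    (\<forall>k\<in>{1..r}. v i \<bullet> (matrix_inv (Q_matrix p v) *v (B k *v v j)) =
                 v i' \<bullet> (matrix_inv (Q_matrix p v) *v (B k *v v j')))"
  by (auto simp: edge_weight_def matrix_vector_mul_assoc simp del: upt_Suc)

text \<open>Commutation gives \<open>B k *v v (\<sigma> j) = A *v (B k *v v j)\<close>, so both
  arguments of the invariant form are images under \<open>A\<close>.\<close>

lemma edge_weight_perm_if_Lin_gens:
  assumes span: "span (v ` {1..p}) = UNIV"
    and \<sigma>: "\<sigma> \<in> Lin_gens p v (B ` {1..r})" and ij: "i \<in> {1..p}" "j \<in> {1..p}"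
  shows "edge_weight p v r B (\<sigma> i) (\<sigma> j) = edge_weight p v r B i j"
proof -
  obtain A where perm: "\<sigma> permutes {1..p}" and comm: "\<And>k. k \<in> {1..r} \<Longrightarrow> A ** B k = B k ** A"
    and A: "\<And>i. i \<in> {1..p} \<Longrightarrow> A *v v i = v (\<sigma> i)"
    using \<sigma> unfolding Lin_gens_def GL_gens_comm_def by blast
  have "B k *v v (\<sigma> j) = A *v (B k *v v j)" if "k \<in> {1..r}" for k
    using A[OF ij(2)] comm[OF that] by (metis matrix_vector_mul_assoc)
  then show ?thesis
    unfolding edge_weight_eq_iff
    using inner_inverse_Q_matrix_invariant[where v = v, OF span perm A, of "v i"] A[OF ij(1)] by simp
qed

lemma Lin_gens_if_edge_weight_perm:
  fixes v :: "nat \<Rightarrow> real^'n"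
  assumes span: "span (v ` {1..p}) = UNIV"
    and r: "r \<ge> 1" and B1: "B 1 = mat 1"
    and \<sigma>: "\<sigma> permutes {1..p}"
    and w: "\<And>i j. i \<in> {1..p} \<Longrightarrow> j \<in> {1..p} \<Longrightarrow>
      edge_weight p v r B (\<sigma> i) (\<sigma> j) = edge_weight p v r B i j"
  shows "\<sigma> \<in> Lin_gens p v (B ` {1..r})"
proof -
  let ?Q = "Q_matrix p v" and ?P = "matrix_inv (Q_matrix p v)"
  have QP: "?Q *v (?P *v x) = x" for x
    by (simp add: matrix_vector_mul_assoc matrix_inv_Q_matrix[OF span])
  have wk: "v (\<sigma> i) \<bullet> (?P *v (B k *v v (\<sigma> j))) = v i \<bullet> (?P *v (B k *v v j))"
    if "i \<in> {1..p}" "j \<in> {1..p}" "k \<in> {1..r}" for i j k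
    using w[OF that(1,2)] that(3) by (simp add: edge_weight_eq_iff)
  \<comment> \<open>The component belonging to \<open>B 1\<close>, the identity, says that
    \<open>\<sigma>\<close> preserves the form itself on generators.\<close>
  have w1: "v (\<sigma> i) \<bullet> (?P *v v (\<sigma> j)) = v i \<bullet> (?P *v v j)"
    if "i \<in> {1..p}" "j \<in> {1..p}" for i j
    using wk[OF that, of 1] r B1 by simp
  have img: "(\<lambda>i. v (\<sigma> i)) ` {1..p} = v ` {1..p}"
    using permutes_image[OF \<sigma>] by (metis image_image)
  then have span': "span ((\<lambda>i. v (\<sigma> i)) ` {1..p}) = UNIV" using span by simp
  \<comment> \<open>Testing against a spanning set gives \<open>?P *v x = ?P *v y\<close>, and
    applying \<open>?Q\<close> recovers \<open>x = y\<close>.\<close>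
  have P_eqI: "x = y" if "\<And>i. i \<in> {1..p} \<Longrightarrow> v (\<sigma> i) \<bullet> (?P *v x) = v (\<sigma> i) \<bullet> (?P *v y)" for x y
    using eq_if_inner_spanning_eq[OF span' that] by (metis QP)
  define f where "f x = (\<Sum>i=1..p. (v i \<bullet> (?P *v x)) *\<^sub>R v (\<sigma> i))" for x
  have "linear f"
    unfolding f_def
    by (rule linearI) (simp_all add: matrix_vector_right_distrib inner_add_right scaleR_add_left
        sum.distrib scaleR_sum_right matrix_vector_mult_scaleR)
  define A where "A = matrix f"
  have Af: "A *v x = f x" for x unfolding A_def using \<open>linear f\<close>
    by (metis linear_matrix_vector_mul_eq matrix_works)
  have A: "A *v v j = v (\<sigma> j)" if j: "j \<in> {1..p}" for j
  proof (rule P_eqI)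
    fix k assume k: "k \<in> {1..p}"
    have "v (\<sigma> k) \<bullet> (?P *v (A *v v j)) =
        (\<Sum>i=1..p. (v i \<bullet> (?P *v v j)) * (v (\<sigma> k) \<bullet> (?P *v v (\<sigma> i))))"
      by (simp add: Af f_def linear_sum[OF matrix_vector_mul_linear] matrix_vector_mult_scaleR
          inner_sum_right)
    also have "\<dots> = (\<Sum>i=1..p. (v i \<bullet> (?P *v v j)) * (v k \<bullet> (?P *v v i)))"
      by (intro sum.cong refl) (simp only: w1[OF k])
    \<comment> \<open>The sum of the \<open>v i\<close> with coefficients
      \<open>v i \<bullet> (?P *v v j)\<close> is \<open>?Q\<close> applied to
      \<open>?P *v v j\<close>, which is \<open>v j\<close>.\<close>
    also have "\<dots> = v k \<bullet> (?P *v (?Q *v (?P *v v j)))"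
      by (subst Q_matrix_mult_vec) (simp add: linear_sum[OF matrix_vector_mul_linear]
          matrix_vector_mult_scaleR inner_sum_right)
    also have "\<dots> = v (\<sigma> k) \<bullet> (?P *v v (\<sigma> j))" by (simp only: QP w1[OF k j])
    finally show "v (\<sigma> k) \<bullet> (?P *v (A *v v j)) = v (\<sigma> k) \<bullet> (?P *v v (\<sigma> j))" .
  qed
  \<comment> \<open>\<open>A\<close> maps the set of generators onto itself, so its range contains a
    spanning set.\<close>
  have "surj ((*v) A)"
  proof -
    have "(*v) A ` (v ` {1..p}) = (\<lambda>i. v (\<sigma> i)) ` {1..p}"
      unfolding image_image using A by (intro image_cong refl)
    then have "(*v) A ` (v ` {1..p}) = v ` {1..p}" by (simp only: img)
    then have "span (v ` {1..p}) = (*v) A ` span (v ` {1..p})"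
      by (metis linear_span_image matrix_vector_mul_linear)
    then show ?thesis using span by simp
  qed
  then have "invertible A"
    by (simp add: invertible_right_inverse matrix_right_invertible_surjective)
  moreover have "A ** B k = B k ** A" if k: "k \<in> {1..r}" for k
  proof -
    have eq: "A *v (B k *v v j) = B k *v (A *v v j)" if j: "j \<in> {1..p}" for j
    proof (rule P_eqI)
      fix i assume i: "i \<in> {1..p}"
      \<comment> \<open>Since \<open>A\<close> is now known to permute the generators, the form is
        invariant under \<open>A\<close> at all vectors, in particular at \<open>B k *v v j\<close>,
        which need not be a generator.\<close>
      have "v (\<sigma> i) \<bullet> (?P *v (A *v (B k *v v j))) = v i \<bullet> (?P *v (B k *v v j))"
        using inner_inverse_Q_matrix_invariant[where v = v, OF span \<sigma> A, of "v i"] A[OF i] by simp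
      then show "v (\<sigma> i) \<bullet> (?P *v (A *v (B k *v v j))) = v (\<sigma> i) \<bullet> (?P *v (B k *v (A *v v j)))"
        by (simp only: A[OF j] wk[OF i j k])
    qed
    have "(A ** B k) *v x = (B k ** A) *v x" for x
    proof -
      have on_gens: "(A ** B k) *v y = (B k ** A) *v y" if "y \<in> v ` {1..p}" for y
        using that eq by (auto simp flip: matrix_vector_mul_assoc)
      have "x \<in> span (v ` {1..p})" using span by simp
      then show ?thesis
        using linear_eq_on[OF matrix_vector_mul_linear matrix_vector_mul_linear] on_gens by blast
    qed
    then show ?thesis by (simp add: matrix_eq)
  qed
  ultimately have "A \<in> GL_gens_comm p v (B ` {1..r})"
    using A \<sigma> by (auto simp: GL_gens_comm_def GL_gens_def)
  then show ?thesis unfolding Lin_gens_def using A \<sigma> by blast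
qed

section \<open>Group structure and the colored digraph\<close>

lemma subgroup_weight_preserving_perms:
  "subgroup {\<sigma>. \<sigma> permutes {1..p} \<and> (\<forall>i\<in>{1..p}. \<forall>j\<in>{1..p}. w (\<sigma> i) (\<sigma> j) = w i j)} (sym_group p)"
    (is "subgroup ?G _")
proof (rule group.subgroupI[OF sym_group_is_group])
  show "?G \<subseteq> carrier (sym_group p)" by (auto simp: sym_group_carrier)
  show "?G \<noteq> {}" by (auto intro!: exI[of _ id] simp: permutes_id)
next
  fix \<sigma> assume "\<sigma> \<in> ?G"
  then have \<sigma>: "\<sigma> permutes {1..p}" and w: "\<And>i j. i \<in> {1..p} \<Longrightarrow> j \<in> {1..p} \<Longrightarrow> w (\<sigma> i) (\<sigma> j) = w i j"
    by auto
  have inv: "inv' \<sigma> permutes {1..p}" using \<sigma> by (rule permutes_inv)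
  have "w (inv' \<sigma> i) (inv' \<sigma> j) = w i j" if "i \<in> {1..p}" "j \<in> {1..p}" for i j
    \<comment> \<open>Invariance under \<open>\<sigma>\<close>, read at the preimages of
      \<open>i\<close> and \<open>j\<close>, is invariance under the inverse.\<close>
    using w[of "inv' \<sigma> i" "inv' \<sigma> j"] that inv \<sigma> permutes_in_image[OF inv]
    by (simp add: permutes_inverses)
  then show "inv\<^bsub>sym_group p\<^esub> \<sigma> \<in> ?G"
    using inv \<sigma> sym_group_inv_equality[of \<sigma> p] by (simp add: sym_group_carrier)
next
  fix \<sigma> \<tau> assume "\<sigma> \<in> ?G" "\<tau> \<in> ?G"
  then show "\<sigma> \<otimes>\<^bsub>sym_group p\<^esub> \<tau> \<in> ?G"
    using permutes_in_image[of \<tau> "{1..p}"]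
    by (auto simp: sym_group_mult permutes_compose simp del: atLeastAtMost_iff)
qed

theorem theorem2:
  fixes C :: "(real^'n) set"
    and R :: "nat \<Rightarrow> (real^'n) set"
    and v :: "nat \<Rightarrow> real^'n"
    and B :: "nat \<Rightarrow> real^'n^'n"
    and p r :: nat
  assumes cone: "polyhedral_cone C" "full_dimensional C" "pointed C"
    and rays: "bij_betw R {1..p} (extreme_rays C)"
    and gens: "\<And>i. i \<in> {1..p} \<Longrightarrow> R i = ray_of (v i)"
    and r: "r \<ge> 1"
    and B1: "B 1 = mat 1"
  defines "w \<equiv> edge_weight p v r B"
  shows "subgroup (Lin_gens p v (B ` {1..r})) (sym_group p) \<and>
         Lin_gens p v (B ` {1..r}) = colored_digraph_auts {1..p} (\<lambda>i. w i i) w \<and>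
         Lin_gens p v (B ` {1..r}) =
           {\<sigma>. \<sigma> permutes {1..p} \<and> (\<forall>i\<in>{1..p}. \<forall>j\<in>{1..p}. w (\<sigma> i) (\<sigma> j) = w i j)}"
proof -
  have "extreme_rays C = (\<lambda>i. ray_of (v i)) ` {1..p}"
    using bij_betw_imp_surj_on[OF rays] gens by (metis (no_types, lifting) image_cong)
  then have span: "span (v ` {1..p}) = UNIV"
    by (rule span_ray_generators[OF cone])
  have Lin: "Lin_gens p v (B ` {1..r}) =
      {\<sigma>. \<sigma> permutes {1..p} \<and> (\<forall>i\<in>{1..p}. \<forall>j\<in>{1..p}. w (\<sigma> i) (\<sigma> j) = w i j)}"
    (is "?L = ?G")
  proof
    show "?L \<subseteq> ?G"
    proof
      fix \<sigma> assume \<sigma>: "\<sigma> \<in> ?L"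
      then have "\<sigma> permutes {1..p}" by (simp add: Lin_gens_def)
      then show "\<sigma> \<in> ?G" unfolding w_def using edge_weight_perm_if_Lin_gens[OF span \<sigma>] by blast
    qed
    show "?G \<subseteq> ?L"
      using Lin_gens_if_edge_weight_perm[where B = B, OF span r B1] unfolding w_def by blast
  qed
  \<comment> \<open>The condition on all pairs splits into the diagonal, giving the vertex colors,
    and the pairs of distinct vertices, giving the edge colors.\<close>
  moreover have "\<dots> = colored_digraph_auts {1..p} (\<lambda>i. w i i) w"
    unfolding colored_digraph_auts_def by (intro Collect_cong) metis
  ultimately show ?thesis using subgroup_weight_preserving_perms[of p w] by simp
qed

end
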